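(* Let $r,s$ be coprime positive integers and let $n\ge 2$ be an integer such that $x:=(r,n)\le y:=(s,n)$. Let $$f(t)=\frac{(t^{rs}-1)(t-1)}{(t^s-1)(t^r-1)}\in\mathbb{Z}[t]$$ (the Alexander polynomial of the torus knot $K(r,s)$) and $g(t)=t^n-1\in\mathbb{Z}[t]$. Then the Smith form over $\mathbb{Z}$ of the $n\times n$ integer matrix $f(C_g)$ has non-unit invariant factors $$\frac{r}{x}\ (\text{repeated } y-x \text{ times}),\qquad \frac{rs}{xy}\ (\text{repeated } x-1\text{ times}),\qquad 0\ (\text{repeated } (x-1)(y-1)\text{ times});$$ that is, the $n$ invariant factors of $f(C_g)$ are those in this list, together with $1$ repeated the remaining $n-x(y-1)$ times.
   Context: $(a,b)$ denotes the (non-negative) greatest common divisor of integers $a,b$. For a monic polynomial $g(t)=t^n+\sum_{k=0}^{n-1}g_kt^k\in\mathbb{Z}[t]$, the companion matrix $C_g\in\mathbb{Z}^{n\times n}$ has first row $(-g_{n-1},\dots,-g_1,-g_0)$, entries $1$ in positions $(i+1,i)$ for $1\le i\le n-1$, and $0$ elsewhere. For $f(t)=\sum_kf_kt^k$, $f(C_g)=\sum_kf_kC_g^k$. The Smith form of an integer matrix $M$ is the diagonal matrix $S=UMV$, with $U,V$ integer matrices of determinant $\pm1$, whose diagonal entries (the invariant factors) are non-negative and satisfy $S_{i,i}\mid S_{i+1,i+1}$. *)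

theory Defs
  imports
    "Jordan_Normal_Form.Determinant"
    "HOL-Computational_Algebra.Polynomial"
begin

text \<open>Indices are shifted by one with respect to the usual matrix notation: they start at 0.\<close>

definition companion_matrix :: "'a::comm_ring_1 poly \<Rightarrow> 'a mat" where
  "companion_matrix g = mat (degree g) (degree g)
     (\<lambda>(i, j). if i = 0 then - coeff g (degree g - 1 - j) else if i = j + 1 then 1 else 0)"

text \<open>The evaluation \<open>f(A)\<close> of a polynomial at a square matrix. The sum of the matrices
  \<open>f\<^sub>k A\<^sup>k\<close> is written entrywise, because matrices of unspecified dimension have no zero
  and so no \<^const>\<open>sum\<close>.\<close>

definition poly_matrix :: "'a::comm_ring_1 poly \<Rightarrow> 'a mat \<Rightarrow> 'a mat" where
  "poly_matrix f A = mat (dim_row A) (dim_row A)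
     (\<lambda>(i, j). \<Sum>k\<le>degree f. coeff f k * (A ^\<^sub>m k) $$ (i, j))"

definition is_smith_form :: "int mat \<Rightarrow> int mat \<Rightarrow> bool" where
  "is_smith_form M S \<longleftrightarrow>
     (\<exists>U V. U \<in> carrier_mat (dim_row M) (dim_row M) \<and> V \<in> carrier_mat (dim_col M) (dim_col M) \<and>
            det U \<in> {1, -1} \<and> det V \<in> {1, -1} \<and> S = U * M * V) \<and>
     diagonal_mat S \<and>
     (\<forall>i < min (dim_row S) (dim_col S). 0 \<le> S $$ (i, i)) \<and>
     (\<forall>i. i + 1 < min (dim_row S) (dim_col S) \<longrightarrow> S $$ (i, i) dvd S $$ (i + 1, i + 1))"

text \<open>For coprime positive \<open>r\<close> and \<open>s\<close> the division below is exact; see the lemma that follows.\<close>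

definition torus_knot_poly :: "nat \<Rightarrow> nat \<Rightarrow> int poly" where
  "torus_knot_poly r s =
     ((monom 1 (r * s) - 1) * (monom 1 1 - 1)) div ((monom 1 s - 1) * (monom 1 r - 1))"

lemma torus_knot_poly_exact:
  assumes rs: "coprime r s" and r: "0 < r" and s: "0 < s"
  shows "torus_knot_poly r s * ((monom 1 s - 1) * (monom 1 r - 1)) =
           (monom 1 (r * s) - 1) * (monom 1 1 - 1)"
proof -
  define T :: "int poly" where "T = monom 1 1"
  define G where "G k = (\<Sum>i<k. T ^ i)" for k
  have T: "monom 1 k = T ^ k" for k
    by (simp add: T_def monom_power)
  have G: "T ^ k - 1 = (T - 1) * G k" for k
    unfolding G_def by (rule power_diff_1_eq)
  have T1: "T - 1 \<noteq> 0"
    by (metis T T_def diff_eq_diff_eq degree_1 degree_monom_eq one_neq_zero right_minus_eq)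
  have dvd: "G a dvd G (a * b)" for a b
  proof -
    have "T ^ (a * b) - 1 = (T ^ a - 1) * (\<Sum>i<b. (T ^ a) ^ i)"
      by (simp add: power_mult power_diff_1_eq)
    then have "(T - 1) * G (a * b) = (T - 1) * (G a * (\<Sum>i<b. (T ^ a) ^ i))"
      by (simp only: G mult.assoc)
    then show ?thesis
      using T1 by (auto simp: dvd_def)
  qed
  obtain u v where uv: "r * u = s * v + 1"
    using bezout_nat[of r s] rs r by (auto simp: coprime_iff_gcd_eq_1)
  have "G (r * u) - T * G (s * v) = 1"
    unfolding uv G_def using sum.lessThan_Suc_shift[of "\<lambda>i. T ^ i" "s * v"]
    by (simp add: sum_distrib_left del: sum.lessThan_Suc)
  then have one: "1 = G (r * u) - T * G (s * v)" ..
  obtain a b where ab: "G (r * u) = G r * a" "G (s * v) = G s * b"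
    using dvd by (meson dvdE)
  obtain c d where cd: "G (r * s) = G r * c" "G (r * s) = G s * d"
    using dvd[of r s] dvd[of s r] by (metis dvdE mult.commute)
  have "G (r * s) = G (r * s) * (G r * a - T * (G s * b))"
    using one ab by simp
  also have "\<dots> = G r * a * (G s * d) - T * (G s * b) * (G r * c)"
    using cd by (metis mult.commute right_diff_distrib')
  also have "\<dots> = (G r * G s) * (a * d - T * b * c)"
    by (simp add: algebra_simps)
  finally have "G (r * s) = (G r * G s) * (a * d - T * b * c)" .
  then have "(T ^ (r * s) - 1) * (T - 1) =
      ((T ^ s - 1) * (T ^ r - 1)) * (a * d - T * b * c)"
    unfolding G by (simp only: mult_ac)
  then have "(T ^ s - 1) * (T ^ r - 1) dvd (T ^ (r * s) - 1) * (T - 1)"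
    by simp
  then show ?thesis
    unfolding torus_knot_poly_def T T_def[symmetric] by (simp add: T)
qed

end

theory Submission
  imports Defs
begin

text \<open>
  The matrix \<open>f(C\<^sub>g)\<close> is multiplication by \<open>f\<close> on \<open>\<int>[t]/(t\<^sup>n - 1)\<close> in the basis \<open>1, t, \<dots>, t\<^sup>n\<^sup>-\<^sup>1\<close>. A
  Smith form therefore amounts to two bases of this group, with \<open>f\<close> sending each member of the first to
  an integer multiple of a member of the second (\<open>smith_form_of_diagonal_form\<close>).

  Write \<open>[k] = 1 + t + \<dots> + t\<^sup>k\<^sup>-\<^sup>1\<close>, so that \<open>f [r] [s] = [r s]\<close>, and let \<open>z\<close> be the torus knot polynomial of
  \<open>x, y\<close>, so that \<open>z [x] [y] = [x y]\<close>. Everything rests on the ideal \<open>([a], [b])\<close> being generated by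
  \<open>[gcd a b]\<close> (\<open>q_integer_bezout\<close>). It yields \<open>f = z F\<close> for some \<open>F\<close> (\<open>torus_knot_poly_factor\<close>), while
  \<open>t\<^sup>n - 1 = z H (t - 1) [x] [y]\<close> with \<open>H = [n]/[x y]\<close>. The factors of \<open>t\<^sup>n - 1\<close> play different roles.

  \<^item> The common factor \<open>z\<close>, of degree \<open>(x - 1)(y - 1)\<close>, contributes the zeros.
  \<^item> \<open>F\<close> is a unit modulo \<open>H\<close>, since it divides \<open>[r s]/[x y]\<close> and \<open>gcd (r s) n = x y\<close>. It is a unit modulo
    \<open>t - 1\<close>, since \<open>F(1) = 1\<close>. Both factors contribute ones.
  \<^item> Modulo \<open>[x]\<close> the power \<open>t\<^sup>x\<close> is \<open>1\<close>, and \<open>F\<close> becomes the constant \<open>s/y\<close> up to a unit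
    (\<open>diagonal_form_q_integer\<close>). By symmetry it becomes \<open>r/x\<close> modulo \<open>[y]\<close>. As \<open>[x]\<close> and \<open>[y]\<close> are
    comaximal, they contribute \<open>x - 1\<close> entries \<open>s/y\<close> and \<open>y - 1\<close> entries \<open>r/x\<close>.

  Finally \<open>r/x\<close> and \<open>s/y\<close> are coprime, so each of the \<open>x - 1\<close> entries \<open>s/y\<close> can be merged with an entry
  \<open>r/x\<close> into the pair \<open>1, r s/(x y)\<close> (\<open>diagonal_form_merge\<close>). This leaves \<open>y - x\<close> entries \<open>r/x\<close>.
\<close>

interpretation int_poly: Modules.module "smult :: int \<Rightarrow> int poly \<Rightarrow> int poly"
  by unfold_locales (auto simp: smult_add_right smult_add_left)

section \<open>Comaximal elements\<close>

definition comaximal :: "'a::comm_ring_1 \<Rightarrow> 'a \<Rightarrow> bool" where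
  "comaximal a b \<longleftrightarrow> (\<exists>u v. u * a + v * b = 1)"

lemma comaximal_sym: "comaximal a b \<Longrightarrow> comaximal b a"
  unfolding comaximal_def by (metis add.commute)

lemma comaximal_dvd: "comaximal a b \<Longrightarrow> a' dvd a \<Longrightarrow> b' dvd b \<Longrightarrow> comaximal a' b'"
  unfolding comaximal_def dvd_def by (metis mult.assoc mult.commute)

text \<open>The substitute for Euclid's lemma: \<^typ>\<open>int poly\<close> is not a principal ideal ring, so
  comaximality has to replace coprimality.\<close>

lemma comaximal_mult_dvd:
  assumes "comaximal a b" and "a dvd b * c"
  shows "a dvd c"
proof -
  obtain u v where "u * a + v * b = 1"
    using assms(1) unfolding comaximal_def by blast
  then have "c = (u * a + v * b) * c"
    by simp
  also have "\<dots> = a * (u * c) + v * (b * c)"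
    by (simp add: algebra_simps)
  finally have c: "c = a * (u * c) + v * (b * c)" .
  have "a dvd a * (u * c) + v * (b * c)"
    using assms(2) by simp
  then show ?thesis by (simp flip: c)
qed

section \<open>Generators of quotients of the integer polynomial ring\<close>

text \<open>The residue classes of \<open>B\<close> generate \<open>\<int>[t]/(g)\<close> as an abelian group. When \<open>g\<close> is monic and \<open>B\<close>
  has \<open>degree g\<close> elements, they are then even a basis.\<close>

definition generates_mod :: "int poly \<Rightarrow> int poly set \<Rightarrow> bool" where
  "generates_mod g B \<longleftrightarrow> (\<forall>p. \<exists>q \<in> int_poly.span B. g dvd p - q)"

lemma span_image_mult: "q \<in> int_poly.span B \<Longrightarrow> h * q \<in> int_poly.span ((*) h ` B)"
proof (induction q rule: int_poly.span_induct_alt)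
  case base
  then show ?case by (simp add: int_poly.span_zero)
next
  case (step c x y)
  have "h * (smult c x + y) = smult c (h * x) + h * y"
    by (simp add: distrib_left)
  then show ?case
    using step by (auto intro: int_poly.span_add int_poly.span_scale int_poly.span_base)
qed

lemma generates_mod_subset_span:
  assumes "generates_mod g B" and "B \<subseteq> int_poly.span B'"
  shows "generates_mod g B'"
  using assms unfolding generates_mod_def
  by (metis int_poly.span_minimal int_poly.subspace_span subsetD)

text \<open>Multiplication by a unit of \<open>\<int>[t]/(g)\<close> is an automorphism of this group.\<close>

lemma generates_mod_mult_unit:
  assumes "comaximal u g" and "generates_mod g B"
  shows "generates_mod g ((*) u ` B)"
  unfolding generates_mod_def
proof
  fix p
  obtain a b where ab: "a * u + b * g = 1"
    using assms(1) unfolding comaximal_def by blast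
  obtain q where q: "q \<in> int_poly.span B" "g dvd a * p - q"
    using assms(2) unfolding generates_mod_def by blast
  have "p - u * q = (a * u + b * g) * p - u * q"
    by (simp add: ab)
  also have "\<dots> = u * (a * p - q) + g * (b * p)"
    by (simp add: algebra_simps)
  finally have "g dvd p - u * q"
    using q(2) by simp
  then show "\<exists>q\<in>int_poly.span ((*) u ` B). g dvd p - q"
    using span_image_mult[OF q(1)] by blast
qed

text \<open>The short exact sequence \<open>0 \<rightarrow> \<int>[t]/(k) \<rightarrow> \<int>[t]/(h k) \<rightarrow> \<int>[t]/(h) \<rightarrow> 0\<close>, whose first map
  is multiplication by \<open>h\<close>: generators of the two ends give generators of the middle. This is
  how bases are assembled along a factorisation of the modulus.\<close>

lemma generates_mod_mult:
  assumes "generates_mod h B" and "generates_mod k C"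
  shows "generates_mod (h * k) (B \<union> (*) h ` C)"
  unfolding generates_mod_def
proof
  fix p
  obtain q where q: "q \<in> int_poly.span B" "h dvd p - q"
    using assms(1) unfolding generates_mod_def by blast
  then obtain m where m: "p - q = h * m" by (auto simp: dvd_def)
  obtain l where l: "l \<in> int_poly.span C" "k dvd m - l"
    using assms(2) unfolding generates_mod_def by blast
  have "p - (q + h * l) = h * (m - l)"
    using m by (simp add: algebra_simps)
  then have "h * k dvd p - (q + h * l)"
    using l(2) by simp
  moreover have "q + h * l \<in> int_poly.span (B \<union> (*) h ` C)"
    using q(1) span_image_mult[OF l(1), of h]
    by (intro int_poly.span_add) (use int_poly.span_mono in blast)+
  ultimately show "\<exists>q\<in>int_poly.span (B \<union> (*) h ` C). h * k dvd p - q" by blast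
qed

lemma monic_remainder:
  fixes g p :: "int poly"
  assumes "lead_coeff g = 1"
  obtains q where "g dvd p - q" and "q = 0 \<or> degree q < degree g"
proof -
  have "g \<noteq> 0" using assms by auto
  obtain q r where "pseudo_divmod p g = (q, r)" by fastforce
  note pseudo_divmod[OF \<open>g \<noteq> 0\<close> this]
  then have "g dvd p - r" "r = 0 \<or> degree r < degree g"
    using assms by simp_all
  then show ?thesis using that by blast
qed

text \<open>For monic \<open>g\<close> the group \<open>\<int>[t]/(g)\<close> is torsion-free.\<close>

lemma monic_dvd_smult_cancel:
  fixes g p :: "int poly"
  assumes "lead_coeff g = 1" and "c \<noteq> 0" and "g dvd smult c p"
  shows "g dvd p"
proof -
  obtain q where q: "g dvd p - q" "q = 0 \<or> degree q < degree g"
    using monic_remainder[OF assms(1)] .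
  have "g dvd smult c p - smult c (p - q)"
    by (rule dvd_diff[OF assms(3) dvd_smult[OF q(1)]])
  then have "g dvd smult c q"
    by (simp add: smult_diff_right)
  then have "degree g \<le> degree q" if "q \<noteq> 0"
    using assms(2) that dvd_imp_degree_le[of g "smult c q"] by simp
  then have "q = 0"
    using q(2) by linarith
  then show ?thesis using q(1) by simp
qed

lemma generates_mod_powers:
  assumes "lead_coeff g = 1"
  shows "generates_mod g (monom 1 ` {..<degree g})"
  unfolding generates_mod_def
proof
  fix p
  obtain q where q: "g dvd p - q" "q = 0 \<or> degree q < degree g"
    using monic_remainder[OF assms] .
  have monom: "monom a i \<in> int_poly.span (monom 1 ` {..<degree g})" if "i < degree g" for a i
    using that int_poly.span_scale[of "monom 1 i" _ a]
    by (simp add: smult_monom int_poly.span_base)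
  have "q \<in> int_poly.span (monom 1 ` {..<degree g})" if "q \<noteq> 0"
  proof -
    have "(\<Sum>i\<le>degree q. monom (coeff q i) i) \<in> int_poly.span (monom 1 ` {..<degree g})"
      using q(2) that by (intro int_poly.span_sum monom) fastforce
    then show ?thesis by (simp only: poly_as_sum_of_monoms)
  qed
  then show "\<exists>q\<in>int_poly.span (monom 1 ` {..<degree g}). g dvd p - q"
    using q(1) int_poly.span_zero by blast
qed

section \<open>Diagonal forms of multiplication maps\<close>

text \<open>Each triple \<open>(d, b, c)\<close> says that multiplication by \<open>f\<close> sends \<open>b\<close> to \<open>d c\<close> in \<open>\<int>[t]/(g)\<close>. For
  monic \<open>g\<close> the \<open>b\<close>s and the \<open>c\<close>s are two bases, so \<open>D\<close> is the diagonal of a matrix equivalent to the one of this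
  multiplication; the divisibility chain of a Smith form is not part of the notion. A multiset keeps
  the triples free of any order, which matters only once the matrix is written down.\<close>

definition diagonal_form :: "int poly \<Rightarrow> int poly \<Rightarrow> int multiset \<Rightarrow> bool" where
  "diagonal_form f g D \<longleftrightarrow>
     (\<exists>T. image_mset fst T = D \<and> size T = degree g \<and>
          (\<forall>(d, b, c) \<in># T. g dvd f * b - smult d c) \<and>
          generates_mod g ((\<lambda>(d, b, c). b) ` set_mset T) \<and>
          generates_mod g ((\<lambda>(d, b, c). c) ` set_mset T))"

lemma diagonal_formE:
  assumes "diagonal_form f g D"
  obtains T :: "(int \<times> int poly \<times> int poly) multiset" where "image_mset fst T = D" "size T = degree g"
    "\<And>d b c. (d, b, c) \<in># T \<Longrightarrow> g dvd f * b - smult d c"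
    "generates_mod g ((\<lambda>(d, b, c). b) ` set_mset T)"
    "generates_mod g ((\<lambda>(d, b, c). c) ` set_mset T)"
  using assms unfolding diagonal_form_def by blast

lemma diagonal_form_size: "diagonal_form f g D \<Longrightarrow> size D = degree g"
  by (auto simp: diagonal_form_def)

text \<open>If \<open>f\<close> is the constant \<open>d\<close> up to a unit \<open>u\<close>, the powers of \<open>t\<close> are one basis and their multiples
  by \<open>u\<close> the other.\<close>

lemma diagonal_form_scalar:
  assumes g: "lead_coeff g = 1" and u: "comaximal u g" and d: "g dvd f * u - [:d:]"
  shows "diagonal_form f g (replicate_mset (degree g) d)"
proof -
  define T :: "(int \<times> int poly \<times> int poly) multiset"
    where "T = image_mset (\<lambda>i. (d, u * monom 1 i, monom 1 i)) (mset_set {..<degree g})"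
  have "g dvd f * (u * monom 1 i) - smult d (monom 1 i)" for i
  proof -
    have "f * (u * monom 1 i) - smult d (monom 1 i) = (f * u - [:d:]) * monom 1 i"
      by (simp add: left_diff_distrib mult.assoc)
    then show ?thesis using d by simp
  qed
  then have "\<forall>(d, b, c) \<in># T. g dvd f * b - smult d c"
    by (auto simp: T_def)
  moreover have "(\<lambda>(d, b, c). b) ` set_mset T = (*) u ` monom 1 ` {..<degree g}"
    "(\<lambda>(d, b, c). c) ` set_mset T = monom 1 ` {..<degree g}"
    by (auto simp: T_def image_image)
  moreover have "image_mset fst T = replicate_mset (degree g) d"
    by (simp add: T_def image_mset.compositionality comp_def image_mset_const_eq)
  ultimately show ?thesis
    unfolding diagonal_form_def
    using generates_mod_powers[OF g] generates_mod_mult_unit[OF u]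
    by (intro exI[of _ T]) (simp add: T_def)
qed

text \<open>As \<open>f\<close> is a unit modulo \<open>h\<close>, the powers \<open>t\<^sup>i\<close> and their images \<open>f t\<^sup>i\<close> both
  generate \<open>\<int>[t]/(h)\<close>, so they extend the bases for \<open>k\<close> with invariant \<open>1\<close>.\<close>

lemma diagonal_form_times_unit:
  assumes h: "lead_coeff h = 1" and "k \<noteq> 0" and fh: "comaximal f h" and fk: "diagonal_form f k D"
  shows "diagonal_form f (h * k) (D + replicate_mset (degree h) 1)"
proof -
  obtain T where T: "image_mset fst T = D" "size T = degree k"
    "\<And>d b c. (d, b, c) \<in># T \<Longrightarrow> k dvd f * b - smult d c"
    "generates_mod k ((\<lambda>(d, b, c). b) ` set_mset T)"
    "generates_mod k ((\<lambda>(d, b, c). c) ` set_mset T)"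
    using diagonal_formE[OF fk] by blast
  define S where "S = image_mset (\<lambda>(d, b, c). (d, h * b, h * c)) T +
    image_mset (\<lambda>i. (1::int, monom 1 i, f * monom 1 i)) (mset_set {..<degree h})"
  have "h * k dvd f * (h * b) - smult d (h * c)" if "(d, b, c) \<in># T" for d b c
  proof -
    have "f * (h * b) - smult d (h * c) = h * (f * b - smult d c)"
      by (simp add: algebra_simps)
    then show ?thesis using T(3)[OF that] by simp
  qed
  then have "\<forall>(d, b, c) \<in># S. h * k dvd f * b - smult d c"
    by (auto simp: S_def)
  moreover have "(\<lambda>(d, b, c). b) ` set_mset S =
      monom 1 ` {..<degree h} \<union> (*) h ` (\<lambda>(d, b, c). b) ` set_mset T"
    "(\<lambda>(d, b, c). c) ` set_mset S =
      (*) f ` monom 1 ` {..<degree h} \<union> (*) h ` (\<lambda>(d, b, c). c) ` set_mset T"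
    by (force simp: S_def image_image image_Un split_def)+
  moreover have "image_mset fst S = D + replicate_mset (degree h) 1"
    by (auto simp: S_def T(1)[symmetric] image_mset.compositionality comp_def image_mset_const_eq split_def)
  moreover have "size S = degree (h * k)"
    using assms(1,2) T(2) by (subst degree_mult_eq) (auto simp: S_def)
  ultimately show ?thesis
    unfolding diagonal_form_def
    using generates_mod_powers[OF h] generates_mod_mult_unit[OF fh] generates_mod_mult T(4,5)
    by (intro exI[of _ S]) simp
qed

text \<open>On \<open>\<int>[t]/(z g)\<close>, the kernel of multiplication by \<open>z f\<close> contains the multiples of \<open>g\<close>,
  and its image lies in the multiples of \<open>z\<close>. Thus \<open>g t\<^sup>i\<close> completes the first basis and \<open>t\<^sup>i\<close> the second, both for
  \<open>i < degree z\<close>, with invariant \<open>0\<close>.\<close>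

lemma diagonal_form_common_factor:
  assumes z: "lead_coeff z = 1" and "g \<noteq> 0" and fg: "diagonal_form f g D"
  shows "diagonal_form (z * f) (z * g) (D + replicate_mset (degree z) 0)"
proof -
  obtain T where T: "image_mset fst T = D" "size T = degree g"
    "\<And>d b c. (d, b, c) \<in># T \<Longrightarrow> g dvd f * b - smult d c"
    "generates_mod g ((\<lambda>(d, b, c). b) ` set_mset T)"
    "generates_mod g ((\<lambda>(d, b, c). c) ` set_mset T)"
    using diagonal_formE[OF fg] by blast
  define S where "S = image_mset (\<lambda>(d, b, c). (d, b, z * c)) T +
    image_mset (\<lambda>i. (0::int, g * monom 1 i, monom 1 i)) (mset_set {..<degree z})"
  have "z * g dvd z * f * b - smult d (z * c)" if "(d, b, c) \<in># T" for d b c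
  proof -
    have "z * f * b - smult d (z * c) = z * (f * b - smult d c)"
      by (simp add: algebra_simps)
    then show ?thesis using T(3)[OF that] by simp
  qed
  then have "\<forall>(d, b, c) \<in># S. z * g dvd z * f * b - smult d c"
    by (auto simp: S_def)
  moreover have "(\<lambda>(d, b, c). b) ` set_mset S =
      (\<lambda>(d, b, c). b) ` set_mset T \<union> (*) g ` monom 1 ` {..<degree z}"
    "(\<lambda>(d, b, c). c) ` set_mset S =
      monom 1 ` {..<degree z} \<union> (*) z ` (\<lambda>(d, b, c). c) ` set_mset T"
    by (force simp: S_def image_image image_Un split_def)+
  moreover have "image_mset fst S = D + replicate_mset (degree z) 0"
    by (auto simp: S_def T(1)[symmetric] image_mset.compositionality comp_def image_mset_const_eq split_def)
  moreover have "size S = degree (z * g)"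
    using assms(1,2) T(2) by (subst degree_mult_eq) (auto simp: S_def)
  ultimately show ?thesis
    unfolding diagonal_form_def
    using generates_mod_powers[OF z] generates_mod_mult[of z _ g] generates_mod_mult[of g _ z] T(4,5)
    by (intro exI[of _ S]) (simp add: mult.commute)
qed

text \<open>The Chinese remainder theorem: multiplication by \<open>k\<close> carries a basis for \<open>h\<close> into the first
  summand of \<open>\<int>[t]/(h k)\<close>, and \<open>k\<close> is a unit modulo \<open>h\<close>.\<close>

lemma diagonal_form_comaximal:
  assumes hk: "comaximal h k" and "h \<noteq> 0" "k \<noteq> 0"
    and fh: "diagonal_form f h D" and fk: "diagonal_form f k E"
  shows "diagonal_form f (h * k) (D + E)"
proof -
  obtain T where T: "image_mset fst T = D" "size T = degree h"
    "\<And>d b c. (d, b, c) \<in># T \<Longrightarrow> h dvd f * b - smult d c"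
    "generates_mod h ((\<lambda>(d, b, c). b) ` set_mset T)"
    "generates_mod h ((\<lambda>(d, b, c). c) ` set_mset T)"
    using diagonal_formE[OF fh] by blast
  obtain S where S: "image_mset fst S = E" "size S = degree k"
    "\<And>d b c. (d, b, c) \<in># S \<Longrightarrow> k dvd f * b - smult d c"
    "generates_mod k ((\<lambda>(d, b, c). b) ` set_mset S)"
    "generates_mod k ((\<lambda>(d, b, c). c) ` set_mset S)"
    using diagonal_formE[OF fk] by blast
  define R where "R = image_mset (\<lambda>(d, b, c). (d, k * b, k * c)) T +
    image_mset (\<lambda>(d, b, c). (d, h * b, h * c)) S"
  have scaled: "h * k dvd f * (m * b) - smult d (m * c)"
    if "l dvd f * b - smult d c" "m * l = h * k" for d b c m l
  proof -
    have "f * (m * b) - smult d (m * c) = m * (f * b - smult d c)"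
      by (simp add: algebra_simps)
    moreover have "m * l dvd m * (f * b - smult d c)"
      using that(1) by (rule mult_dvd_mono[OF dvd_refl])
    ultimately show ?thesis using that(2) by simp
  qed
  have "\<forall>(d, b, c) \<in># R. h * k dvd f * b - smult d c"
    by (auto simp: R_def intro: scaled[OF T(3)] scaled[OF S(3)])
  moreover have "(\<lambda>(d, b, c). b) ` set_mset R =
      (*) k ` (\<lambda>(d, b, c). b) ` set_mset T \<union> (*) h ` (\<lambda>(d, b, c). b) ` set_mset S"
    "(\<lambda>(d, b, c). c) ` set_mset R =
      (*) k ` (\<lambda>(d, b, c). c) ` set_mset T \<union> (*) h ` (\<lambda>(d, b, c). c) ` set_mset S"
    by (force simp: R_def image_image image_Un split_def)+
  moreover have "image_mset fst R = D + E"
    by (auto simp: R_def T(1)[symmetric] S(1)[symmetric] image_mset.compositionality comp_def split_def)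
  moreover have "size R = degree (h * k)"
    using assms(2,3) T(2) S(2) by (subst degree_mult_eq) (auto simp: R_def)
  ultimately show ?thesis
    unfolding diagonal_form_def
    using generates_mod_mult_unit[OF comaximal_sym[OF hk]] generates_mod_mult T(4,5) S(4,5)
    by (intro exI[of _ R]) simp
qed

text \<open>The isomorphism \<open>\<int>/d \<oplus> \<int>/e \<cong> \<int>/(d e)\<close> for coprime \<open>d\<close> and \<open>e\<close>, carried out on bases.\<close>

lemma diagonal_form_merge:
  assumes "coprime d e" and "diagonal_form f g (add_mset d (add_mset e D))"
  shows "diagonal_form f g (add_mset 1 (add_mset (d * e) D))"
proof -
  obtain T' where T': "image_mset fst T' = add_mset d (add_mset e D)" "size T' = degree g"
    "\<And>d b c. (d, b, c) \<in># T' \<Longrightarrow> g dvd f * b - smult d c"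
    "generates_mod g ((\<lambda>(d, b, c). b) ` set_mset T')"
    "generates_mod g ((\<lambda>(d, b, c). c) ` set_mset T')"
    using diagonal_formE[OF assms(2)] by blast
  obtain b c b' c' T where T: "T' = add_mset (d, b, c) (add_mset (e, b', c') T)"
      "image_mset fst T = D"
    using T'(1) by (auto dest!: msed_map_invR)
  obtain u v where uv: "u * d + v * e = 1"
    using assms(1) bezout_int[of d e] by auto
  \<comment> \<open>With the Bezout relation \<open>u d + v e = 1\<close>, both changes of basis have determinant \<open>-1\<close>.\<close>
  define b1 b2 c1 c2 where defs: "b1 = smult u b + smult v b'" "b2 = smult e b - smult d b'"
    "c1 = smult (u * d) c + smult (v * e) c'" "c2 = c - c'"
  define S where "S = add_mset (1, b1, c1) (add_mset (d * e, b2, c2) T)"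
  have bc: "g dvd f * b - smult d c" "g dvd f * b' - smult e c'"
    using T'(3) T(1) by auto
  have "f * b1 - smult 1 c1 = smult u (f * b - smult d c) + smult v (f * b' - smult e c')"
    "f * b2 - smult (d * e) c2 = smult e (f * b - smult d c) - smult d (f * b' - smult e c')"
    by (simp_all add: defs algebra_simps smult_add_right smult_diff_right)
  then have "g dvd f * b1 - smult 1 c1" "g dvd f * b2 - smult (d * e) c2"
    using bc by (simp_all add: dvd_smult dvd_diff dvd_add del: smult_1_left)
  then have "\<forall>(d, b, c) \<in># S. g dvd f * b - smult d c"
    using T'(3) T(1) by (auto simp: S_def)
  moreover have "generates_mod g ((\<lambda>(d, b, c). b) ` set_mset S)"
  proof (rule generates_mod_subset_span[OF T'(4)])
    let ?S = "int_poly.span ((\<lambda>(d, b, c). b) ` set_mset S)"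
    have "smult d b1 + smult v b2 = smult (u * d + v * e) b"
      "smult e b1 - smult u b2 = smult (u * d + v * e) b'"
      by (simp_all add: defs algebra_simps smult_add_right smult_diff_right smult_add_left)
    then have eq: "b = smult d b1 + smult v b2" "b' = smult e b1 - smult u b2"
      by (simp_all add: uv)
    have mem: "b1 \<in> ?S" "b2 \<in> ?S"
      by (auto simp: S_def intro: int_poly.span_base)
    have "b \<in> ?S"
      unfolding eq(1) by (intro int_poly.span_add int_poly.span_scale mem)
    moreover have "b' \<in> ?S"
      unfolding eq(2) by (intro int_poly.span_diff int_poly.span_scale mem)
    moreover have "(\<lambda>(d, b, c). b) ` set_mset T \<subseteq> ?S"
      by (rule subset_trans[OF _ int_poly.span_superset]) (simp add: S_def, blast)
    ultimately show "(\<lambda>(d, b, c). b) ` set_mset T' \<subseteq> ?S"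
      by (simp add: T(1))
  qed
  moreover have "generates_mod g ((\<lambda>(d, b, c). c) ` set_mset S)"
  proof (rule generates_mod_subset_span[OF T'(5)])
    let ?S = "int_poly.span ((\<lambda>(d, b, c). c) ` set_mset S)"
    have "c1 + smult (v * e) c2 = smult (u * d + v * e) c"
      "c1 - smult (u * d) c2 = smult (u * d + v * e) c'"
      by (simp_all add: defs algebra_simps smult_add_right smult_diff_right smult_add_left)
    then have eq: "c = c1 + smult (v * e) c2" "c' = c1 - smult (u * d) c2"
      by (simp_all add: uv)
    have mem: "c1 \<in> ?S" "c2 \<in> ?S"
      by (auto simp: S_def intro: int_poly.span_base)
    have "c \<in> ?S"
      unfolding eq(1) by (intro int_poly.span_add int_poly.span_scale mem)
    moreover have "c' \<in> ?S"
      unfolding eq(2) by (intro int_poly.span_diff int_poly.span_scale mem)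
    moreover have "(\<lambda>(d, b, c). c) ` set_mset T \<subseteq> ?S"
      by (rule subset_trans[OF _ int_poly.span_superset]) (simp add: S_def, blast)
    ultimately show "(\<lambda>(d, b, c). c) ` set_mset T' \<subseteq> ?S"
      by (simp add: T(1))
  qed
  moreover have "image_mset fst S = add_mset 1 (add_mset (d * e) D)" "size S = degree g"
    using T T'(2) by (simp_all add: S_def)
  ultimately show ?thesis
    unfolding diagonal_form_def by (intro exI[of _ S]) simp
qed

lemma diagonal_form_merge_all:
  assumes "coprime d e"
    and "diagonal_form f g (D + replicate_mset m d + replicate_mset m e)"
  shows "diagonal_form f g (D + replicate_mset m 1 + replicate_mset m (d * e))"
  using assms(2)
proof (induction m arbitrary: D)
  case (Suc m)
  have "diagonal_form f g (add_mset d (add_mset e (D + replicate_mset m d + replicate_mset m e)))"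
    using Suc.prems by (simp add: add_mset_commute)
  from diagonal_form_merge[OF assms(1) this]
  have "diagonal_form f g (add_mset 1 (add_mset (d * e) D) + replicate_mset m d + replicate_mset m e)"
    by simp
  from Suc.IH[OF this] show ?case
    by (simp add: add_mset_commute)
qed simp

section \<open>From bases to matrices\<close>

lemma sum_if_mod_eq:
  fixes n :: nat and g :: "nat \<Rightarrow> int"
  assumes "0 < n"
  shows "(\<Sum>j<n. g j * (if m mod n = j then c else 0)) = g (m mod n) * c"
proof -
  have "(\<Sum>j<n. g j * (if m mod n = j then c else 0)) =
      (\<Sum>j<n. if m mod n = j then g j * c else 0)"
    by (intro sum.cong) auto
  then show ?thesis using assms by simp
qed

text \<open>The \<open>i\<close>-th coordinate of \<open>p\<close> modulo \<open>t\<^sup>n - 1\<close> with respect to \<open>1, t, \<dots>, t\<^sup>n\<^sup>-\<^sup>1\<close>: reduction folds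
  the exponents modulo \<open>n\<close>.\<close>

definition folded_coeff :: "nat \<Rightarrow> int poly \<Rightarrow> nat \<Rightarrow> int" where
  "folded_coeff n p i = (\<Sum>k\<le>degree p. if k mod n = i then coeff p k else 0)"

lemma folded_coeff_bounded_degree:
  assumes "degree p \<le> N"
  shows "folded_coeff n p i = (\<Sum>k\<le>N. if k mod n = i then coeff p k else 0)"
  unfolding folded_coeff_def
  by (rule sum.mono_neutral_left) (use assms in \<open>auto simp: coeff_eq_0\<close>)

lemma folded_coeff_add: "folded_coeff n (p + q) i = folded_coeff n p i + folded_coeff n q i"
  unfolding folded_coeff_bounded_degree[OF degree_add_le_max[of p q]]
    folded_coeff_bounded_degree[OF max.cobounded1[of "degree p" "degree q"]]
    folded_coeff_bounded_degree[OF max.cobounded2[of "degree q" "degree p"]]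
  by (auto simp: sum.distrib[symmetric] intro!: sum.cong)

lemma folded_coeff_smult: "folded_coeff n (smult c p) i = c * folded_coeff n p i"
  by (subst folded_coeff_bounded_degree[OF degree_smult_le])
    (auto simp: folded_coeff_def sum_distrib_left intro!: sum.cong)

lemma folded_coeff_diff: "folded_coeff n (p - q) i = folded_coeff n p i - folded_coeff n q i"
  using folded_coeff_add[of n p "smult (- 1) q" i] folded_coeff_smult[of n "- 1" q i] by simp

lemma folded_coeff_0: "folded_coeff n 0 i = 0"
  using folded_coeff_smult[of n 0 0 i] by simp

lemma folded_coeff_sum: "folded_coeff n (sum h A) i = (\<Sum>a\<in>A. folded_coeff n (h a) i)"
  by (induction A rule: infinite_finite_induct) (simp_all add: folded_coeff_0 folded_coeff_add)

lemma folded_coeff_monom: "folded_coeff n (monom c k) i = (if k mod n = i then c else 0)"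
proof -
  have "folded_coeff n (monom c k) i = (\<Sum>m\<le>k. if m mod n = i then coeff (monom c k) m else 0)"
    by (rule folded_coeff_bounded_degree) (rule degree_monom_le)
  also have "\<dots> = (\<Sum>m\<le>k. if m = k then (if k mod n = i then c else 0) else 0)"
    by (intro sum.cong) auto
  finally show ?thesis by simp
qed

lemma folded_coeff_mult_monom:
  "folded_coeff n (p * monom c k) i =
     (\<Sum>m\<le>degree p. if (m + k) mod n = i then coeff p m * c else 0)"
proof -
  have "p * monom c k = (\<Sum>m\<le>degree p. monom (coeff p m * c) (m + k))"
    by (subst poly_as_sum_of_monoms[of p, symmetric]) (simp add: sum_distrib_right mult_monom)
  then show ?thesis
    by (simp add: folded_coeff_sum folded_coeff_monom)
qed

text \<open>Multiplication by \<open>t\<^sup>n\<close> raises every exponent by \<open>n\<close>, so it does not change the folding.\<close>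

lemma folded_coeff_cong:
  assumes "monom 1 n - 1 dvd p - q"
  shows "folded_coeff n p i = folded_coeff n q i"
proof -
  obtain h where "p - q = (monom 1 n - 1) * h"
    using assms by (auto simp: dvd_def)
  then have "p - q = h * monom 1 n - h * monom 1 0"
    by (simp add: algebra_simps monom_0 flip: one_pCons)
  then have "folded_coeff n (p - q) i = 0"
    by (simp only: folded_coeff_diff folded_coeff_mult_monom) simp
  then show ?thesis by (simp add: folded_coeff_diff)
qed

text \<open>The companion matrix of \<open>t\<^sup>n - 1\<close> is the permutation matrix of \<open>j \<mapsto> j + 1\<close> modulo \<open>n\<close>, which is
  multiplication by \<open>t\<close> on the basis \<open>1, t, \<dots>, t\<^sup>n\<^sup>-\<^sup>1\<close>.\<close>

definition cyclic_shift :: "nat \<Rightarrow> int mat" where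
  "cyclic_shift n = companion_matrix (monom 1 n - 1)"

lemma degree_monom_minus_1: "0 < n \<Longrightarrow> degree (monom 1 n - 1 :: int poly) = n"
  using degree_add_eq_left[of "- 1 :: int poly" "monom 1 n"] by (simp add: degree_monom_eq)

lemma lead_coeff_monom_minus_1: "0 < n \<Longrightarrow> lead_coeff (monom 1 n - 1 :: int poly) = 1"
  by (simp add: degree_monom_minus_1)

lemma cyclic_shift_carrier: "0 < n \<Longrightarrow> cyclic_shift n \<in> carrier_mat n n"
  by (simp add: cyclic_shift_def companion_matrix_def degree_monom_minus_1)

lemma cyclic_shift_index:
  assumes "i < n" and "j < n"
  shows "cyclic_shift n $$ (i, j) = (if (j + 1) mod n = i then 1 else 0)"
proof (cases "j + 1 = n")
  case True
  then show ?thesis using assms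
    by (auto simp: cyclic_shift_def companion_matrix_def degree_monom_minus_1)
next
  case False
  then have "j + 1 < n" using assms by simp
  then show ?thesis using assms
    by (auto simp: cyclic_shift_def companion_matrix_def degree_monom_minus_1)
qed

lemma cyclic_shift_power_index:
  assumes "i < n" and "j < n"
  shows "(cyclic_shift n ^\<^sub>m k) $$ (i, j) = (if (k + j) mod n = i then 1 else 0)"
  using assms(2)
proof (induction k arbitrary: j)
  case 0
  then show ?case using assms(1) cyclic_shift_carrier[of n] by auto
next
  case (Suc k)
  have n: "0 < n" using Suc.prems by simp
  note C = cyclic_shift_carrier[OF n]
  have "(cyclic_shift n ^\<^sub>m Suc k) $$ (i, j) =
      (\<Sum>l<n. (cyclic_shift n ^\<^sub>m k) $$ (i, l) * cyclic_shift n $$ (l, j))"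
    using assms(1) Suc.prems C pow_carrier_mat[OF C, of k]
    by (auto simp: scalar_prod_def atLeast0LessThan)
  also have "\<dots> = (\<Sum>l<n. (cyclic_shift n ^\<^sub>m k) $$ (i, l) * (if (j + 1) mod n = l then 1 else 0))"
    using Suc.prems by (intro sum.cong) (auto simp: cyclic_shift_index)
  also have "\<dots> = (cyclic_shift n ^\<^sub>m k) $$ (i, (j + 1) mod n)"
    by (subst sum_if_mod_eq[OF n]) simp
  also have "\<dots> = (if (Suc k + j) mod n = i then 1 else 0)"
    using n by (subst Suc.IH) (simp_all add: mod_simps)
  finally show ?case .
qed

lemma poly_matrix_cyclic_shift_carrier:
  "0 < n \<Longrightarrow> poly_matrix f (cyclic_shift n) \<in> carrier_mat n n"
  using cyclic_shift_carrier[of n] by (simp add: poly_matrix_def)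

lemma poly_matrix_cyclic_shift_index:
  assumes "i < n" and "j < n"
  shows "poly_matrix f (cyclic_shift n) $$ (i, j) = folded_coeff n (f * monom 1 j) i"
proof -
  have "dim_row (cyclic_shift n) = n"
    using assms cyclic_shift_carrier[of n] by auto
  then show ?thesis
    using assms
    by (auto simp: poly_matrix_def cyclic_shift_power_index folded_coeff_mult_monom intro!: sum.cong)
qed

text \<open>In coordinates, \<open>f\<close> evaluated at the companion matrix is multiplication by \<open>f\<close>. Both sides are
  additive in \<open>p\<close>, so monomials suffice.\<close>

lemma folded_coeff_mult:
  assumes "i < n"
  shows "folded_coeff n (f * p) i =
    (\<Sum>j<n. poly_matrix f (cyclic_shift n) $$ (i, j) * folded_coeff n p j)"
proof -
  define M where "M = (\<lambda>j. poly_matrix f (cyclic_shift n) $$ (i, j))"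
  have n: "0 < n" using assms by simp
  have monom: "folded_coeff n (f * monom c k) i = (\<Sum>j<n. M j * folded_coeff n (monom c k) j)" for c k
  proof -
    have "(\<Sum>j<n. M j * folded_coeff n (monom c k) j) = M (k mod n) * c"
      unfolding folded_coeff_monom by (rule sum_if_mod_eq[OF n])
    also have "\<dots> = folded_coeff n (f * monom c k) i"
      using assms n
      by (auto simp: M_def poly_matrix_cyclic_shift_index folded_coeff_mult_monom mod_simps
          sum_distrib_right intro!: sum.cong)
    finally show ?thesis by simp
  qed
  have p: "p = (\<Sum>k\<le>degree p. monom (coeff p k) k)"
    by (simp add: poly_as_sum_of_monoms)
  have "folded_coeff n (f * p) i = (\<Sum>k\<le>degree p. folded_coeff n (f * monom (coeff p k) k) i)"
    by (subst p) (simp add: sum_distrib_left folded_coeff_sum)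
  also have "\<dots> = (\<Sum>k\<le>degree p. \<Sum>j<n. M j * folded_coeff n (monom (coeff p k) k) j)"
    by (simp only: monom)
  also have "\<dots> = (\<Sum>j<n. M j * folded_coeff n p j)"
    by (subst sum.swap, subst (3) p) (simp add: folded_coeff_sum sum_distrib_left)
  finally show ?thesis by (simp add: M_def)
qed

lemma span_set_nth:
  assumes "q \<in> int_poly.span (set bs)"
  obtains a where "q = (\<Sum>l<length bs. smult (a l) (bs ! l))"
proof -
  have "\<exists>a. q = (\<Sum>l<length bs. smult (a l) (bs ! l))"
    using assms
  proof (induction q rule: int_poly.span_induct_alt)
    case base
    show ?case by (rule exI[of _ "\<lambda>_. 0"]) simp
  next
    case (step c x y)
    then obtain a m where a: "y = (\<Sum>l<length bs. smult (a l) (bs ! l))"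
      and m: "m < length bs" "x = bs ! m"
      by (auto simp: in_set_conv_nth)
    have "smult c x = (\<Sum>l<length bs. smult (if l = m then c else 0) (bs ! l))"
      using m by (simp add: if_distrib[of "\<lambda>c. smult c _"] cong: if_cong)
    then have "smult c x + y = (\<Sum>l<length bs. smult ((if l = m then c else 0) + a l) (bs ! l))"
      by (simp only: a smult_add_left sum.distrib)
    then show ?case 
      by (rule exI[of _ "\<lambda>l. (if l = m then c else 0) + a l"])
  qed
  then show ?thesis using that by blast
qed

definition coordinate_matrix :: "nat \<Rightarrow> int poly list \<Rightarrow> int mat" where
  "coordinate_matrix n bs = mat n n (\<lambda>(i, j). folded_coeff n (bs ! j) i)"

text \<open>Writing the standard basis in terms of \<open>n\<close> generators produces a right inverse of their coordinate
  matrix, over the integers.\<close>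

lemma generates_mod_coordinate_matrix_unimodular:
  assumes "generates_mod (monom 1 n - 1) (set bs)" and len: "length bs = n"
  shows "det (coordinate_matrix n bs) \<in> {1, -1}"
proof -
  have "\<exists>a. monom 1 n - 1 dvd monom 1 j - (\<Sum>l<n. smult (a l) (bs ! l))" for j
    using assms span_set_nth unfolding generates_mod_def by metis
  then obtain a where
    a: "\<And>j. monom 1 n - 1 dvd monom 1 j - (\<Sum>l<n. smult (a j l) (bs ! l))"
    by metis
  define A where "A = mat n n (\<lambda>(l, j). a j l)"
  define B where "B = coordinate_matrix n bs"
  have carr: "A \<in> carrier_mat n n" "B \<in> carrier_mat n n"
    by (simp_all add: A_def B_def coordinate_matrix_def)
  have BA: "B * A = 1\<^sub>m n"
  proof (rule eq_matI)
    fix i j assume "i < dim_row (1\<^sub>m n :: int mat)" "j < dim_col (1\<^sub>m n :: int mat)"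
    then have ij: "i < n" "j < n" by simp_all
    have "(B * A) $$ (i, j) = (\<Sum>l<n. folded_coeff n (bs ! l) i * a j l)"
      using ij by (simp add: A_def B_def coordinate_matrix_def scalar_prod_def atLeast0LessThan)
    also have "\<dots> = folded_coeff n (\<Sum>l<n. smult (a j l) (bs ! l)) i"
      by (simp add: folded_coeff_sum folded_coeff_smult mult.commute)
    also have "\<dots> = folded_coeff n (monom 1 j) i"
      by (rule folded_coeff_cong[OF a, symmetric])
    finally show "(B * A) $$ (i, j) = 1\<^sub>m n $$ (i, j)"
      using ij by (auto simp: folded_coeff_monom)
  qed (use carr in auto)
  have "det B * det A = 1"
    using det_mult[OF carr(2,1)] BA by simp
  then show ?thesis
    by (auto simp: B_def zmult_eq_1_iff)
qed

lemma unimodular_left_inverse: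
  fixes B :: "int mat"
  assumes B: "B \<in> carrier_mat n n" and det: "det B \<in> {1, -1}"
  obtains A where "A \<in> carrier_mat n n" "A * B = 1\<^sub>m n" "det A \<in> {1, -1}"
proof -
  define A where "A = det B \<cdot>\<^sub>m adj_mat B"
  have A: "A \<in> carrier_mat n n"
    using adj_mat(1)[OF B] by (simp add: A_def)
  have AB: "A * B = 1\<^sub>m n"
    using adj_mat(3)[OF B] det
    by (auto simp: A_def mult_smult_assoc_mat[OF adj_mat(1)[OF B] B] intro!: eq_matI)
  have "det A * det B = 1"
    using det_mult[OF A B] AB by simp
  then have "det A \<in> {1, -1}"
    by (auto simp: zmult_eq_1_iff)
  with A AB show ?thesis using that by blast
qed

lemma list_of_image_mset:
  assumes "image_mset h T = mset ds"
  obtains ts where "mset ts = T" "map h ts = ds"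
proof -
  have "\<exists>ts. mset ts = T \<and> map h ts = ds"
    using assms
  proof (induction ds arbitrary: T)
    case (Cons d ds)
    then obtain t T' where "T = add_mset t T'" "h t = d" "image_mset h T' = mset ds"
      by (auto dest!: msed_map_invR)
    moreover from Cons.IH[OF this(3)] obtain ts where "mset ts = T'" "map h ts = ds" by blast
    ultimately show ?case by (intro exI[of _ "t # ts"]) simp
  qed simp
  then show ?thesis using that by blast
qed

text \<open>Let \<open>M\<close> be the matrix of multiplication by \<open>f\<close>, and let \<open>B\<close> and \<open>C\<close> contain the coordinates of the
  two bases. The relations between the bases say \<open>M B = C D\<close>, hence \<open>C\<^sup>-\<^sup>1 M B = D\<close>.\<close>

lemma smith_form_of_diagonal_form:
  assumes n: "0 < n" and "diagonal_form f (monom 1 n - 1) (mset ds)"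
    and nonneg: "\<And>i. i < n \<Longrightarrow> 0 \<le> ds ! i"
    and dvd: "\<And>i. i + 1 < n \<Longrightarrow> ds ! i dvd ds ! (i + 1)"
  shows "is_smith_form (poly_matrix f (companion_matrix (monom 1 n - 1))) (mat_diag n ((!) ds))"
proof -
  obtain T where T: "image_mset fst T = mset ds" "size T = degree (monom 1 n - 1 :: int poly)"
    "\<And>d b c. (d, b, c) \<in># T \<Longrightarrow> monom 1 n - 1 dvd f * b - smult d c"
    "generates_mod (monom 1 n - 1) ((\<lambda>(d, b, c). b) ` set_mset T)"
    "generates_mod (monom 1 n - 1) ((\<lambda>(d, b, c). c) ` set_mset T)"
    using diagonal_formE[OF assms(2)] by blast
  obtain ts where ts: "mset ts = T" "map fst ts = ds"
    using list_of_image_mset[OF T(1)] .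
  define bs cs where "bs = map (\<lambda>(d, b, c). b) ts" and "cs = map (\<lambda>(d, b, c). c) ts"
  have len: "length ts = n"
    using T(2) n ts(1) by (auto simp: degree_monom_minus_1)
  have rel: "monom 1 n - 1 dvd f * bs ! j - smult (ds ! j) (cs ! j)" if "j < n" for j
  proof -
    obtain d b c where "ts ! j = (d, b, c)" by (cases "ts ! j")
    moreover have "ts ! j \<in># T" using that len ts(1) by auto
    ultimately show ?thesis
      using T(3) that len ts(2) by (auto simp: bs_def cs_def)
  qed
  define M B C D where "M = poly_matrix f (cyclic_shift n)" and "B = coordinate_matrix n bs"
    and "C = coordinate_matrix n cs" and "D = mat_diag n ((!) ds)"
  have "generates_mod (monom 1 n - 1) (set bs)" "generates_mod (monom 1 n - 1) (set cs)"
    using T(4,5) ts(1) by (auto simp: bs_def cs_def)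
  moreover have "length bs = n" "length cs = n"
    by (simp_all add: bs_def cs_def len)
  ultimately have B: "det B \<in> {1, -1}" and C: "det C \<in> {1, -1}"
    unfolding B_def C_def by (simp_all only: generates_mod_coordinate_matrix_unimodular)
  have carr: "M \<in> carrier_mat n n" "B \<in> carrier_mat n n" "C \<in> carrier_mat n n" "D \<in> carrier_mat n n"
    by (simp_all add: M_def B_def C_def D_def coordinate_matrix_def
        poly_matrix_cyclic_shift_carrier[OF n])
  obtain A where A: "A \<in> carrier_mat n n" "A * C = 1\<^sub>m n" "det A \<in> {1, -1}"
    using unimodular_left_inverse[OF carr(3) C] .
  have MB: "M * B = C * D"
  proof (rule eq_matI)
    fix i j assume "i < dim_row (C * D)" "j < dim_col (C * D)"
    then have ij: "i < n" "j < n" using carr by simp_all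
    have "(M * B) $$ (i, j) = (\<Sum>l<n. M $$ (i, l) * folded_coeff n (bs ! j) l)"
      using ij carr(1) by (auto simp: B_def coordinate_matrix_def scalar_prod_def atLeast0LessThan)
    also have "\<dots> = folded_coeff n (f * bs ! j) i"
      unfolding M_def by (rule folded_coeff_mult[OF ij(1), symmetric])
    also have "\<dots> = ds ! j * folded_coeff n (cs ! j) i"
      using folded_coeff_cong[OF rel[OF ij(2)]] by (simp add: folded_coeff_smult)
    also have "\<dots> = (C * D) $$ (i, j)"
      unfolding D_def using ij by (subst mat_diag_mult_right[OF carr(3)])
        (simp add: C_def coordinate_matrix_def)
    finally show "(M * B) $$ (i, j) = (C * D) $$ (i, j)" .
  qed (use carr in auto)
  have "A * M * B = A * (M * B)"
    by (rule assoc_mult_mat[OF A(1) carr(1,2)])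
  also have "\<dots> = A * C * D"
    unfolding MB by (rule assoc_mult_mat[OF A(1) carr(3,4), symmetric])
  also have "\<dots> = D"
    unfolding A(2) by (rule left_mult_one_mat[OF carr(4)])
  finally have "A * M * B = D" .
  moreover have "diagonal_mat D"
    by (auto simp: D_def mat_diag_def diagonal_mat_def)
  moreover have "\<exists>U V. U \<in> carrier_mat n n \<and> V \<in> carrier_mat n n \<and>
      det U \<in> {1, -1} \<and> det V \<in> {1, -1} \<and> D = U * M * V"
    using A(1,3) carr(2) B \<open>A * M * B = D\<close> by blast
  moreover have "dim_row M = n" "dim_col M = n"
    using carr(1) by simp_all
  ultimately show ?thesis
    unfolding is_smith_form_def cyclic_shift_def[symmetric] M_def[symmetric] D_def[symmetric]
    using nonneg dvd by (simp add: D_def mat_diag_def)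
qed

section \<open>Divisibility of q-integers\<close>

text \<open>This is \<open>(t\<^sup>a\<^sup>k - 1)/(t\<^sup>a - 1)\<close>. For \<open>a = 1\<close> it is the \<open>q\<close>-integer \<open>[k]\<close>, and in general it is the
  quotient \<open>[a k]/[a]\<close>.\<close>

definition geometric :: "nat \<Rightarrow> nat \<Rightarrow> int poly" where
  "geometric a k = (\<Sum>i<k. monom 1 (a * i))"

definition q_integer :: "nat \<Rightarrow> int poly" where
  "q_integer k = geometric 1 k"

lemma monom_mult_minus_1: "monom 1 (a * k) - 1 = (monom 1 a - 1) * geometric a k"
  using power_diff_1_eq[of "monom 1 a :: int poly" k]
  by (simp add: geometric_def monom_power mult.commute)

lemma monom_minus_1_q_integer: "monom 1 k - 1 = (monom 1 1 - 1) * q_integer k"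
  using monom_mult_minus_1[of 1 k] by (simp add: q_integer_def)

lemma monom_minus_1_neq_0: "0 < k \<Longrightarrow> monom 1 k - 1 \<noteq> (0 :: int poly)"
  using degree_monom_minus_1[of k] by auto

lemma q_integer_mult: "q_integer (a * k) = q_integer a * geometric a k"
proof -
  have "(monom 1 1 - 1) * q_integer (a * k) = (monom 1 1 - 1) * (q_integer a * geometric a k)"
    by (metis monom_minus_1_q_integer monom_mult_minus_1 mult.assoc)
  then show ?thesis
    using monom_minus_1_neq_0[of 1] by (simp only: mult_cancel_left) simp
qed

lemma geometric_monic:
  assumes "0 < a" and "0 < k"
  shows "lead_coeff (geometric a k) = 1"
proof -
  have "lead_coeff (monom 1 (a * k) - 1 :: int poly) =
      lead_coeff (monom 1 a - 1 :: int poly) * lead_coeff (geometric a k)"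
    by (simp only: monom_mult_minus_1 lead_coeff_mult)
  then show ?thesis
    using assms by (simp only: lead_coeff_monom_minus_1 nat_0_less_mult_iff)
qed

lemma degree_geometric:
  assumes "0 < a" and "0 < k"
  shows "degree (geometric a k) = a * k - a"
proof -
  have "geometric a k \<noteq> 0"
    using geometric_monic[OF assms] by auto
  then have "a * k = a + degree (geometric a k)"
    using arg_cong[OF monom_mult_minus_1[of a k], of degree] assms monom_minus_1_neq_0[of a]
    by (simp add: degree_mult_eq degree_monom_minus_1)
  then show ?thesis by simp
qed

lemma q_integer_monic: "0 < k \<Longrightarrow> lead_coeff (q_integer k) = 1"
  by (simp add: q_integer_def geometric_monic)

lemma degree_q_integer: "0 < k \<Longrightarrow> degree (q_integer k) = k - 1"
  by (simp add: q_integer_def degree_geometric)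

lemma q_integer_neq_0: "0 < k \<Longrightarrow> q_integer k \<noteq> 0"
  using q_integer_monic[of k] by auto

lemma q_integer_add: "q_integer (a + b) = q_integer a + monom 1 a * q_integer b"
  by (induction b) (simp_all add: q_integer_def geometric_def distrib_left mult_monom add.assoc)

lemma q_integer_1: "q_integer (Suc 0) = 1"
  by (simp add: q_integer_def geometric_def monom_0 flip: one_pCons)

text \<open>The Bezout relation \<open>a k = b l + g\<close> with \<open>g = gcd a b\<close> turns into \<open>[a k] = [g] + t\<^sup>g [b l]\<close>, where \<open>[a]\<close>
  divides \<open>[a k]\<close> and \<open>[b]\<close> divides \<open>[b l]\<close>. So the ideal generated by two \<open>q\<close>-integers is principal.\<close>

lemma q_integer_bezout:
  assumes "0 < a"
  shows "\<exists>u v. u * q_integer a + v * q_integer b = q_integer (gcd a b)"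
proof -
  obtain k l where kl: "a * k = b * l + gcd a b"
    using bezout_nat[of a b] assms by auto
  have "q_integer (a * k) = q_integer (gcd a b) + monom 1 (gcd a b) * q_integer (b * l)"
    using q_integer_add[of "gcd a b" "b * l"] by (simp add: kl add.commute)
  then have "geometric a k * q_integer a + (- monom 1 (gcd a b) * geometric b l) * q_integer b = q_integer (gcd a b)"
    by (simp add: q_integer_mult algebra_simps)
  then show ?thesis by blast
qed

lemma comaximal_q_integer_cofactors:
  assumes "0 < a" and "q_integer a = q_integer (gcd a b) * p" and "q_integer b = q_integer (gcd a b) * q"
  shows "comaximal p q"
proof -
  obtain u v where "u * q_integer a + v * q_integer b = q_integer (gcd a b)"
    using q_integer_bezout[OF assms(1)] by blast
  then have "q_integer (gcd a b) * (u * p + v * q) = q_integer (gcd a b) * 1"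
    unfolding assms(2,3) by (simp add: algebra_simps)
  moreover have "q_integer (gcd a b) \<noteq> 0"
    using assms(1) by (intro q_integer_neq_0) simp
  ultimately have "u * p + v * q = 1"
    by (simp only: mult_cancel_left) simp
  then show ?thesis unfolding comaximal_def by blast
qed

lemma comaximal_q_integer:
  assumes "0 < a" and "coprime a b"
  shows "comaximal (q_integer a) (q_integer b)"
  using comaximal_q_integer_cofactors[of a b "q_integer a" "q_integer b"] assms
  by (simp add: q_integer_1)

text \<open>Modulo \<open>[a]\<close> the power \<open>t\<^sup>a\<close> is \<open>1\<close>, so each of the \<open>k\<close> terms of \<^const>\<open>geometric\<close> is \<open>1\<close>.\<close>

lemma q_integer_dvd_geometric_minus_const: "q_integer a dvd geometric (a * c) k - [:int k:]"
proof -
  have "q_integer a dvd monom 1 (a * c * i) - 1" for i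
    unfolding monom_minus_1_q_integer[of "a * c * i"] by (simp add: q_integer_mult mult.assoc)
  then have "q_integer a dvd (\<Sum>i<k. monom 1 (a * c * i) - 1)"
    by (intro dvd_sum)
  moreover have "(\<Sum>i<k. monom 1 (a * c * i) - 1) = geometric (a * c) k - [:int k:]"
    by (simp add: geometric_def sum_subtractf of_nat_poly)
  ultimately show ?thesis by simp
qed

section \<open>Torus knot polynomials\<close>

lemma torus_knot_poly_q_integer:
  assumes "coprime r s" and "0 < r" and "0 < s"
  shows "torus_knot_poly r s * (q_integer r * q_integer s) = q_integer (r * s)"
proof -
  let ?T = "monom 1 1 - 1 :: int poly"
  have "(?T * ?T) * (torus_knot_poly r s * (q_integer r * q_integer s)) = (?T * ?T) * q_integer (r * s)"
    using torus_knot_poly_exact[OF assms] monom_minus_1_q_integer[of r] monom_minus_1_q_integer[of s]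
      monom_minus_1_q_integer[of "r * s"]
    by (simp add: mult_ac)
  then show ?thesis
    using monom_minus_1_neq_0[of 1] by simp
qed

lemma torus_knot_poly_monic:
  assumes "coprime x y" and "0 < x" and "0 < y"
  shows "lead_coeff (torus_knot_poly x y) = 1"
  using arg_cong[OF torus_knot_poly_q_integer[OF assms], of lead_coeff] assms
  by (simp add: lead_coeff_mult q_integer_monic)

lemma degree_torus_knot_poly:
  assumes "coprime x y" and "0 < x" and "0 < y"
  shows "degree (torus_knot_poly x y) = (x - 1) * (y - 1)"
proof -
  have "torus_knot_poly x y \<noteq> 0"
    using torus_knot_poly_monic[OF assms] by auto
  then have "degree (torus_knot_poly x y) + ((x - 1) + (y - 1)) = x * y - 1"
    using arg_cong[OF torus_knot_poly_q_integer[OF assms], of degree] assms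
    by (simp add: degree_mult_eq q_integer_neq_0 degree_q_integer)
  moreover obtain a b where "x = Suc a" "y = Suc b"
    using assms by (meson gr0_implies_Suc)
  ultimately show ?thesis by simp
qed

text \<open>From \<open>gcd r (x y) = x\<close> the cofactors \<open>[r]/[x]\<close> and \<open>[x y]/[x]\<close> are comaximal. The torus knot polynomial
  \<open>z\<close> of \<open>x, y\<close> divides the second one, so it is comaximal with \<open>[r]/[x]\<close>, and likewise with \<open>[s]/[y]\<close>.
  As \<open>z\<close> divides the product of both with the torus knot polynomial of \<open>r, s\<close>, it divides the latter.\<close>

lemma torus_knot_poly_factor:
  assumes rs: "coprime r s" and a: "r = x * a" "0 < r" and b: "s = y * b" "0 < s"
  obtains F where "torus_knot_poly r s = torus_knot_poly x y * F"
    "F * geometric x a * geometric y b = geometric (x * y) (a * b)"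
proof -
  have pos: "0 < x" "0 < y" "0 < a" "0 < b"
    using a b by auto
  have xy: "coprime x y" "coprime a y" "coprime b x"
    using rs a(1) b(1) by (auto simp: ac_simps)
  let ?z = "torus_knot_poly x y"
  have z: "q_integer (x * y) = q_integer x * (?z * q_integer y)" "q_integer (x * y) = q_integer y * (?z * q_integer x)"
    using torus_knot_poly_q_integer[OF xy(1) pos(1,2)] by (simp_all add: mult_ac)
  have r: "q_integer r = q_integer x * geometric x a" and s: "q_integer s = q_integer y * geometric y b"
    using a(1) b(1) by (simp_all only: q_integer_mult)
  have "gcd r (x * y) = x" "gcd s (x * y) = y"
    using gcd_mult_distrib_nat[of x a y] gcd_mult_distrib_nat[of y b x] xy a(1) b(1)
    by (simp_all add: mult.commute[of y x])
  then have "comaximal (geometric x a) (?z * q_integer y)" "comaximal (geometric y b) (?z * q_integer x)"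
    using comaximal_q_integer_cofactors[OF a(2), of "x * y"] comaximal_q_integer_cofactors[OF b(2), of "x * y"]
      r s z by simp_all
  then have comax: "comaximal ?z (geometric x a)" "comaximal ?z (geometric y b)"
    by (meson comaximal_sym comaximal_dvd dvd_refl dvd_triv_left)+
  have "(q_integer x * q_integer y) * (torus_knot_poly r s * (geometric x a * geometric y b)) = q_integer (r * s)"
    using torus_knot_poly_q_integer[OF rs a(2) b(2)] r s by (simp add: mult_ac)
  also have "\<dots> = q_integer (x * y) * geometric (x * y) (a * b)"
    using q_integer_mult[of "x * y" "a * b"] a(1) b(1) by (simp add: mult_ac)
  also have "\<dots> = (q_integer x * q_integer y) * (?z * geometric (x * y) (a * b))"
    using z by (simp add: mult_ac)
  finally have eq: "torus_knot_poly r s * (geometric x a * geometric y b) =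
      ?z * geometric (x * y) (a * b)"
    using pos q_integer_neq_0 by simp
  then have "?z dvd geometric x a * (geometric y b * torus_knot_poly r s)"
    by (metis dvd_triv_left mult.assoc mult.commute)
  then have "?z dvd torus_knot_poly r s"
    using comax comaximal_mult_dvd by blast
  then obtain F where F: "torus_knot_poly r s = ?z * F"
    by (auto simp: dvd_def)
  have "?z * (F * geometric x a * geometric y b) = ?z * geometric (x * y) (a * b)"
    using eq F by (simp add: mult.assoc)
  moreover have "?z \<noteq> 0"
    using torus_knot_poly_monic[OF xy(1) pos(1,2)] by auto
  ultimately have "F * geometric x a * geometric y b = geometric (x * y) (a * b)"
    by simp
  then show ?thesis using that F by blast
qed

text \<open>Modulo \<open>[x]\<close> the hypothesis becomes \<open>a F u = a b\<close> with \<open>u = [y b]/[y]\<close>. Torsion-freeness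
  cancels \<open>a\<close>, and \<open>u\<close> is a unit modulo \<open>[x]\<close> because it divides \<open>[y b]\<close>, where \<open>y b\<close> is coprime
  to \<open>x\<close>. So \<open>F\<close> acts as the constant
  \<open>b\<close> up to a unit.\<close>

lemma diagonal_form_q_integer:
  assumes F: "F * geometric x a * geometric y b = geometric (x * y) (a * b)"
    and x: "0 < x" and a: "0 < a" and yb: "0 < y * b" "coprime x (y * b)"
  shows "diagonal_form F (q_integer x) (replicate_mset (x - 1) (int b))"
proof -
  let ?u = "geometric y b"
  have "q_integer x dvd geometric (x * y) (a * b) - [:int (a * b):]"
    by (rule q_integer_dvd_geometric_minus_const)
  moreover have "q_integer x dvd (geometric x a - [:int a:]) * (F * ?u)"
    using q_integer_dvd_geometric_minus_const[of x 1 a] by simp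
  ultimately have "q_integer x dvd (geometric (x * y) (a * b) - [:int (a * b):]) -
      (geometric x a - [:int a:]) * (F * ?u)"
    by (rule dvd_diff)
  also have "\<dots> = smult (int a) (F * ?u - [:int b:])"
  proof -
    have "geometric (x * y) (a * b) = geometric x a * (F * ?u)"
      unfolding F[symmetric] by (simp only: mult_ac)
    then show ?thesis
      by (simp add: left_diff_distrib smult_diff_right)
  qed
  finally have "q_integer x dvd smult (int a) (F * ?u - [:int b:])" .
  then have "q_integer x dvd F * ?u - [:int b:]"
    by (rule monic_dvd_smult_cancel[OF q_integer_monic[OF x], rotated]) (use a in simp)
  moreover have "comaximal ?u (q_integer x)"
  proof (rule comaximal_dvd[OF _ _ dvd_refl])
    show "comaximal (q_integer (y * b)) (q_integer x)"
      using yb by (intro comaximal_q_integer) (simp_all add: coprime_commute)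
    show "?u dvd q_integer (y * b)"
      by (simp add: q_integer_mult)
  qed
  ultimately show ?thesis
    using diagonal_form_scalar[OF q_integer_monic[OF x], of ?u F "int b"] x
    by (simp add: degree_q_integer)
qed

text \<open>The bookkeeping of the factorisation \<open>t\<^sup>n - 1 = z H (t - 1) [x] [y]\<close> with \<open>H = [n]/[x y]\<close>: the factors
  \<open>[x]\<close> and \<open>[y]\<close> carry the torsion, \<open>t - 1\<close> and \<open>H\<close> carry invariants \<open>1\<close>, and \<open>z\<close> carries the zeros.\<close>

lemma torus_knot_diagonal_form:
  fixes r s n x y :: nat
  assumes r: "0 < r" and s: "0 < s" and rs: "coprime r s" and n: "0 < n"
    and x: "x = gcd r n" and y: "y = gcd s n"
  shows "diagonal_form (torus_knot_poly r s) (monom 1 n - 1)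
    (replicate_mset (x - 1) (int (s div y)) + replicate_mset (y - 1) (int (r div x)) +
     replicate_mset (n - x * y + 1) 1 + replicate_mset ((x - 1) * (y - 1)) 0)"
proof -
  have pos: "0 < x" "0 < y" using x y n by simp_all
  define a b where "a = r div x" and "b = s div y"
  have ra: "r = x * a" and sb: "s = y * b"
    using x y by (simp_all add: a_def b_def)
  have ab: "0 < a" "0 < b" using r s ra sb by auto
  have xy: "coprime x y"
    using rs ra sb by auto
  obtain F where F: "torus_knot_poly r s = torus_knot_poly x y * F"
    "F * geometric x a * geometric y b = geometric (x * y) (a * b)"
    using torus_knot_poly_factor[OF rs ra r sb s] .
  have "x * y dvd n"
    using x y xy by (intro divides_mult) simp_all
  then obtain m where m: "n = x * y * m" by (auto simp: dvd_def)
  have m0: "0 < m" using n m by auto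
  \<comment> \<open>\<open>a = r/x\<close> and \<open>b = s/y\<close> share no factor with \<open>m = n/(x y)\<close>, which gives \<open>gcd (r s) n = x y\<close>.\<close>
  have "x * gcd a (y * m) = gcd r n" "y * gcd b (x * m) = gcd s n"
    unfolding gcd_mult_distrib_nat ra sb m by (simp_all only: mult_ac)
  then have "gcd a (y * m) = 1" "gcd b (x * m) = 1"
    using pos unfolding x[symmetric] y[symmetric] by simp_all
  then have "coprime a (y * m)" "coprime b (x * m)"
    by (simp_all only: coprime_iff_gcd_eq_1)
  then have "coprime (a * b) m"
    by simp
  moreover have "gcd (r * s) n = x * y * gcd (a * b) m"
    unfolding gcd_mult_distrib_nat ra sb m by (simp only: mult_ac)
  ultimately have gcd_rs: "gcd (r * s) n = x * y"
    by simp
  define H where "H = geometric (x * y) m"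
  let ?T = "monom 1 1 - 1 :: int poly"
  have "diagonal_form F (q_integer x) (replicate_mset (x - 1) (int b))"
    using rs ra sb s by (intro diagonal_form_q_integer[OF F(2) pos(1) ab(1)]) auto
  moreover have "diagonal_form F (q_integer y) (replicate_mset (y - 1) (int a))"
    using rs ra sb r F(2) by (intro diagonal_form_q_integer[of F y b x a] pos ab) (auto simp: ac_simps)
  ultimately have xy_form: "diagonal_form F (q_integer x * q_integer y)
      (replicate_mset (x - 1) (int b) + replicate_mset (y - 1) (int a))"
    using pos xy by (intro diagonal_form_comaximal comaximal_q_integer q_integer_neq_0)
  \<comment> \<open>Both sides of the defining relation of \<open>F\<close> are evaluated at \<open>1\<close>, where \<open>[x a]/[x]\<close> takes the value \<open>a\<close>.\<close>
  have FT: "comaximal F ?T"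
  proof -
    have "poly F 1 * (int a * int b) = int a * int b"
      using arg_cong[OF F(2), of "\<lambda>p. poly p 1"] by (auto simp: geometric_def poly_sum poly_monom)
    then have "poly (F - 1) 1 = 0" using ab by simp
    then have "[:- 1, 1:] dvd F - 1"
      by (simp only: poly_eq_0_iff_dvd)
    also have "[:- 1, 1:] = ?T"
      by (simp add: monom_Suc monom_0 one_pCons)
    finally have "?T dvd F - 1" .
    then obtain q where "F - 1 = ?T * q" by (auto simp: dvd_def)
    then have "1 * F + (- q) * ?T = 1" by (simp add: algebra_simps)
    then show ?thesis unfolding comaximal_def by blast
  qed
  have T_form: "diagonal_form F (?T * (q_integer x * q_integer y))
      (replicate_mset (x - 1) (int b) + replicate_mset (y - 1) (int a) + replicate_mset (degree ?T) 1)"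
    using pos q_integer_neq_0
    by (intro diagonal_form_times_unit[OF lead_coeff_monom_minus_1 _ FT xy_form]) simp_all
  \<comment> \<open>\<open>F\<close> divides \<open>[r s]/[x y]\<close>, and \<open>H\<close> is \<open>[n]/[x y]\<close>.\<close>
  have FH: "comaximal F H"
  proof -
    have "comaximal (geometric (x * y) (a * b)) H"
      using r s gcd_rs q_integer_mult[of "x * y" "a * b"] q_integer_mult[of "x * y" m] m ra sb
      by (intro comaximal_q_integer_cofactors[of "r * s" n]) (simp_all add: H_def mult_ac)
    moreover have "F dvd geometric (x * y) (a * b)"
      using F(2) by (metis dvd_triv_left mult.assoc)
    ultimately show ?thesis by (meson comaximal_dvd dvd_refl)
  qed
  have H: "lead_coeff H = 1" "degree H = n - x * y"
    using pos m0 geometric_monic[of "x * y" m] degree_geometric[of "x * y" m]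
    by (simp_all add: H_def m)
  have H_form: "diagonal_form F (H * (?T * (q_integer x * q_integer y)))
      (replicate_mset (x - 1) (int b) + replicate_mset (y - 1) (int a) + replicate_mset (degree ?T) 1 +
       replicate_mset (degree H) 1)"
    using pos q_integer_neq_0 monom_minus_1_neq_0[of 1]
    by (intro diagonal_form_times_unit[OF H(1) _ FH T_form]) simp
  have "diagonal_form (torus_knot_poly x y * F)
      (torus_knot_poly x y * (H * (?T * (q_integer x * q_integer y))))
      (replicate_mset (x - 1) (int b) + replicate_mset (y - 1) (int a) + replicate_mset (degree ?T) 1 +
       replicate_mset (degree H) 1 + replicate_mset (degree (torus_knot_poly x y)) 0)"
    using pos q_integer_neq_0 monom_minus_1_neq_0[of 1] H(1)
    by (intro diagonal_form_common_factor[OF torus_knot_poly_monic[OF xy pos] _ H_form]) auto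
  moreover have "torus_knot_poly x y * (H * (?T * (q_integer x * q_integer y))) = monom 1 n - 1"
    using torus_knot_poly_q_integer[OF xy pos] monom_minus_1_q_integer[of n] q_integer_mult[of "x * y" m]
    by (simp add: H_def m mult_ac)
  ultimately show ?thesis
    using degree_monom_minus_1[of 1] degree_torus_knot_poly[OF xy pos]
    by (simp add: F(1) H(2) a_def b_def)
qed

section \<open>The Smith form\<close>

lemma replicate_mset_add: "replicate_mset (m + n) d = replicate_mset m d + replicate_mset n d"
  by (induction m) simp_all

lemma sorted_wrt_dvd_replicate: "sorted_wrt (dvd) (replicate k (d :: int))"
  by (induction k) auto

theorem theorem3:
  fixes r s n x y :: nat
  assumes "0 < r" and "0 < s" and "coprime r s" and "2 \<le> n"
    and "x = gcd r n" and "y = gcd s n" and "x \<le> y"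
  shows "is_smith_form
           (poly_matrix (torus_knot_poly r s) (companion_matrix (monom 1 n - 1)))
           (mat_diag n (\<lambda>i.
             (replicate (n - x * (y - 1)) 1 @
              replicate (y - x) (int (r div x)) @
              replicate (x - 1) (int (r * s div (x * y))) @
              replicate ((x - 1) * (y - 1)) 0) ! i))"
proof -
  define a b where "a = r div x" and "b = s div y"
  have ra: "r = x * a" and sb: "s = y * b"
    using assms(5,6) by (simp_all add: a_def b_def)
  have pos: "0 < x" "0 < y"
    using assms(4,5,6) by simp_all
  have quot: "r * s div (x * y) = b * a"
    using pos unfolding ra sb by (simp add: div_mult_div_if_dvd)
  have "coprime x y" using assms(3) ra sb by auto
  then have "x * y dvd n"
    using assms(5,6) by (intro divides_mult) simp_all
  then have xyn: "x * y \<le> n" using assms(4) by (intro dvd_imp_le) simp_all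
  define ds where "ds = replicate (n - x * (y - 1)) 1 @ replicate (y - x) (int a) @
    replicate (x - 1) (int (b * a)) @ replicate ((x - 1) * (y - 1)) 0"
  \<comment> \<open>Of the \<open>y - 1\<close> entries \<open>a\<close>, \<open>x - 1\<close> are merged with the entries \<open>b\<close>; each merge adds one entry \<open>1\<close>.\<close>
  have split: "y - 1 = (y - x) + (x - 1)" "n - x * (y - 1) = (n - x * y + 1) + (x - 1)"
    using assms(7) pos xyn by (simp_all add: diff_mult_distrib2)
  have "diagonal_form (torus_knot_poly r s) (monom 1 n - 1)
    (replicate_mset (x - 1) (int b) + replicate_mset (y - 1) (int a) +
     replicate_mset (n - x * y + 1) 1 + replicate_mset ((x - 1) * (y - 1)) 0)"
    using torus_knot_diagonal_form[OF assms(1-3) _ assms(5,6)] assms(4) by (simp add: a_def b_def)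
  also have "replicate_mset (x - 1) (int b) + replicate_mset (y - 1) (int a) +
      replicate_mset (n - x * y + 1) 1 + replicate_mset ((x - 1) * (y - 1)) 0 =
      (replicate_mset (y - x) (int a) + replicate_mset (n - x * y + 1) 1 +
       replicate_mset ((x - 1) * (y - 1)) 0) +
      replicate_mset (x - 1) (int b) + replicate_mset (x - 1) (int a)"
    unfolding split(1)[THEN arg_cong, of "\<lambda>k. replicate_mset k (int a)"] replicate_mset_add
    by (simp add: add_ac)
  finally have "diagonal_form (torus_knot_poly r s) (monom 1 n - 1)
      ((replicate_mset (y - x) (int a) + replicate_mset (n - x * y + 1) 1 +
       replicate_mset ((x - 1) * (y - 1)) 0) +
       replicate_mset (x - 1) 1 + replicate_mset (x - 1) (int b * int a))"
    by (rule diagonal_form_merge_all[rotated]) (use assms(3) ra sb in \<open>auto simp: coprime_commute\<close>)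
  also have "(replicate_mset (y - x) (int a) + replicate_mset (n - x * y + 1) 1 +
       replicate_mset ((x - 1) * (y - 1)) 0) +
       replicate_mset (x - 1) 1 + replicate_mset (x - 1) (int b * int a) = mset ds"
    unfolding ds_def split(2) mset_append mset_replicate replicate_mset_add
    by (simp add: add_ac)
  finally have form: "diagonal_form (torus_knot_poly r s) (monom 1 n - 1) (mset ds)" .
  have "size (mset ds) = n"
    using diagonal_form_size[OF form] assms(4) by (simp add: degree_monom_minus_1)
  then have len: "length ds = n" by simp
  have "sorted_wrt (dvd) ds"
    by (auto simp: ds_def sorted_wrt_append sorted_wrt_dvd_replicate)
  then have "ds ! i dvd ds ! (i + 1)" if "i + 1 < n" for i
    using that len by (auto simp: sorted_wrt_iff_nth_less)
  moreover have "0 \<le> ds ! i" if "i < n" for i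
  proof -
    have "\<forall>d \<in> set ds. 0 \<le> d" by (auto simp: ds_def)
    then show ?thesis using that len by auto
  qed
  ultimately show ?thesis
    using smith_form_of_diagonal_form[OF _ form] assms(4)
    by (simp add: ds_def quot flip: a_def)
qed

end
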